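(* Suppose all agents have submodular valuations normalized so that $\mathrm{MMS}_i=1$. Let $\mathcal{A}_{\mathrm{skip}}\subseteq[n]$ be any fixed set of $\lceil 2\ln n\rceil$ agents. Consider the modification of the Single-or-Sample algorithm (with $k=4$ and $\tau=\frac1{24}$) in which the agents in $\mathcal{A}_{\mathrm{skip}}$ are skipped and receive no items, while all remaining agents participate in the algorithm as usual, following the safe strategy. Then, with probability at least $1-\frac1n$, every agent $i\notin\mathcal{A}_{\mathrm{skip}}$ receives value at least $\frac1{24}\mathrm{MMS}_i$.
   Context: Setting: $n$ agents arrive in order $1,\dots,n$; agent $i$ has a monotone valuation $v_i:2^{[m]}\to\mathbb{R}_+$ over $m$ indivisible goods, fixed by an oblivious adversary; $\mathrm{MMS}_i=\max_{(P_1,\dots,P_n)}\min_\ell v_i(P_\ell)$ over partitions of $[m]$ into $n$ bundles. Single-or-Sample algorithm with parameter $k$: set $R_1=[m]$, $t=0$. For $i=1,\dots,n$: agent $i$ observes the remaining set $R_i$ and chooses one of two actions. (Special round) She selects an item $e\in R_i$, receives $\{e\}$; set $R_{i+1}=R_i\setminus\{e\}$ and $t\leftarrow t+1$. (Non-special round) Set $G=R_i$, $j=1$. While $|G|\ge k(n-t)$: agent $i$ specifies a bucket $B_{ij}\subseteq G$ with $|B_{ij}|=k(n-t)$ (possibly depending on earlier draws); an item $e_{ij}$ is picked uniformly at random from $B_{ij}$; set $G\leftarrow G\setminus B_{ij}$, $j\leftarrow j+1$. Agent $i$ receives $A_i=\bigcup_j\{e_{ij}\}$ and $R_{i+1}=R_i\setminus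 A_i$. (In the modification, a skipped agent $i$ leaves $t$ unchanged and $R_{i+1}=R_i$; $n$ remains the total number of agents, including skipped ones.) Safe strategy with threshold $\tau$: if $R_i$ contains an item $e$ with $v_i(\{e\})\ge\tau$, agent $i$ chooses a special round and selects an item of maximum singleton value in $R_i$. Otherwise she chooses the non-special round, and in step $j$ takes $B_{ij}$ to be the $k(n-t)$ items $e$ of $G$ with the largest marginal values $v_i(A_i^{j-1}\cup\{e\})-v_i(A_i^{j-1})$, where $A_i^{j-1}=\{e_{ij'}:j'<j\}$. *)

theory Defs
  imports "HOL-Probability.Probability"
begin

text \<open>Agents are \<open>1, \<dots>, n\<close> and goods are \<open>1, \<dots>, m\<close>, both of type \<^typ>\<open>nat\<close>.
  A valuation is a function \<^typ>\<open>nat set \<Rightarrow> real\<close> of which only the values on subsets of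
  \<open>{1..m}\<close> matter. The value of the empty set is not required to be \<open>0\<close>.\<close>

definition monotone_valuation :: "nat \<Rightarrow> (nat set \<Rightarrow> real) \<Rightarrow> bool" where
  "monotone_valuation m v \<longleftrightarrow>
     (\<forall>X. X \<subseteq> {1..m} \<longrightarrow> 0 \<le> v X) \<and> mono_on (Pow {1..m}) v"

definition submodular :: "nat \<Rightarrow> (nat set \<Rightarrow> real) \<Rightarrow> bool" where
  "submodular m v \<longleftrightarrow>
     (\<forall>X Y. X \<subseteq> {1..m} \<longrightarrow> Y \<subseteq> {1..m} \<longrightarrow> v (X \<union> Y) + v (X \<inter> Y) \<le> v X + v Y)"

text \<open>Bundles of a partition may be empty, as is usual for the maximin share.\<close>

definition bundle_partition :: "nat \<Rightarrow> nat \<Rightarrow> (nat \<Rightarrow> nat set) \<Rightarrow> bool" where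
  "bundle_partition n m P \<longleftrightarrow>
     (\<Union>l\<in>{1..n}. P l) = {1..m} \<and> disjoint_family_on P {1..n}"

definition MMS :: "nat \<Rightarrow> nat \<Rightarrow> (nat set \<Rightarrow> real) \<Rightarrow> real" where
  "MMS n m v = Max {Min ((\<lambda>l. v (P l)) ` {1..n}) | P. bundle_partition n m P}"

text \<open>The strategy of one agent. The arguments \<open>R\<close> and \<open>t\<close> are the remaining goods and the number of
  special rounds at her arrival. The value \<open>select R t = Some e\<close> means that she takes a special round
  and receives \<open>e\<close>; \<open>select R t = None\<close> means a non-special round. In a non-special round,
  \<open>bucket R t es G\<close> is the bucket that she specifies after the draws \<open>es\<close> (in order), when the
  goods not yet in a bucket are \<open>G\<close>.\<close>

record strategy =
  select :: "nat set \<Rightarrow> nat \<Rightarrow> nat option"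
  bucket :: "nat set \<Rightarrow> nat \<Rightarrow> nat list \<Rightarrow> nat set \<Rightarrow> nat set"

text \<open>The while loop of a non-special round with bucket size \<open>s\<close>, returning the list of draws. The
  conditions other than \<open>s \<le> card G\<close> only make the function total: they stop the loop if the bucket is
  not one that the algorithm permits, which does not happen for the strategies considered below.\<close>

function sample_loop ::
    "(nat list \<Rightarrow> nat set \<Rightarrow> nat set) \<Rightarrow> nat \<Rightarrow> nat set \<Rightarrow> nat list \<Rightarrow> nat list pmf" where
  "sample_loop b s G es =
     (if s \<le> card G \<and> 0 < s \<and> b es G \<subseteq> G \<and> card (b es G) = s
      then bind_pmf (pmf_of_set (b es G)) (\<lambda>e. sample_loop b s (G - b es G) (es @ [e]))
      else return_pmf es)"
  by pat_completeness auto
termination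
proof (relation "Wellfounded.measure (\<lambda>(b, s, G, es). card G)", goal_cases)
  case 1
  then show ?case by simp
next
  case (2 b s G es e)
  then have "finite G"
    by (metis card.infinite not_le)
  moreover from 2 have "b es G \<noteq> {}" "b es G \<subseteq> G"
    by auto
  then have "G - b es G \<subset> G"
    by blast
  ultimately show ?case
    by (simp add: psubset_card_mono)
qed

declare sample_loop.simps [simp del]

text \<open>A state consists of the remaining goods, the number of special rounds so far and the allocation
  so far.\<close>

type_synonym state = "nat set \<times> nat \<times> (nat \<Rightarrow> nat set)"

definition agent_round :: "nat \<Rightarrow> nat \<Rightarrow> (nat \<Rightarrow> strategy) \<Rightarrow> nat \<Rightarrow> state \<Rightarrow> state pmf" where
  "agent_round k n \<sigma> i = (\<lambda>(R, t, A).
     case select (\<sigma> i) R t of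
       Some e \<Rightarrow> return_pmf (R - {e}, Suc t, A(i := {e}))
     | None \<Rightarrow> map_pmf (\<lambda>es. (R - set es, t, A(i := set es)))
                (sample_loop (bucket (\<sigma> i) R t) (k * (n - t)) R []))"

text \<open>The state after the arrivals of agents \<open>1, \<dots>, i\<close>, where the agents in \<open>S\<close> are skipped.\<close>

primrec single_or_sample_state ::
    "nat \<Rightarrow> nat \<Rightarrow> nat \<Rightarrow> nat set \<Rightarrow> (nat \<Rightarrow> strategy) \<Rightarrow> nat \<Rightarrow> state pmf" where
  "single_or_sample_state k n m S \<sigma> 0 = return_pmf ({1..m}, 0, \<lambda>_. {})"
| "single_or_sample_state k n m S \<sigma> (Suc i) =
     bind_pmf (single_or_sample_state k n m S \<sigma> i)
       (\<lambda>st. if Suc i \<in> S then return_pmf st else agent_round k n \<sigma> (Suc i) st)"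

definition single_or_sample ::
    "nat \<Rightarrow> nat \<Rightarrow> nat \<Rightarrow> nat set \<Rightarrow> (nat \<Rightarrow> strategy) \<Rightarrow> (nat \<Rightarrow> nat set) pmf" where
  "single_or_sample k n m S \<sigma> = map_pmf (\<lambda>(R, t, A). A) (single_or_sample_state k n m S \<sigma> n)"

definition marginal :: "(nat set \<Rightarrow> real) \<Rightarrow> nat set \<Rightarrow> nat \<Rightarrow> real" where
  "marginal v A e = v (A \<union> {e}) - v A"

text \<open>A predicate rather than a function, since ties among singleton values and among marginal values
  may be broken arbitrarily.\<close>

definition safe_strategy ::
    "nat \<Rightarrow> nat \<Rightarrow> nat \<Rightarrow> real \<Rightarrow> (nat set \<Rightarrow> real) \<Rightarrow> strategy \<Rightarrow> bool" where
  "safe_strategy k n m \<tau> v s \<longleftrightarrow>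
     (\<forall>R t. R \<subseteq> {1..m} \<longrightarrow> t < n \<longrightarrow>
       (if \<exists>e\<in>R. \<tau> \<le> v {e}
        then \<exists>e\<in>R. select s R t = Some e \<and> (\<forall>e'\<in>R. v {e'} \<le> v {e})
        else select s R t = None \<and>
          (\<forall>es G. G \<subseteq> R \<longrightarrow> set es \<subseteq> R - G \<longrightarrow> k * (n - t) \<le> card G \<longrightarrow>
             (let B = bucket s R t es G in
                B \<subseteq> G \<and> card B = k * (n - t) \<and>
                (\<forall>e\<in>B. \<forall>e'\<in>G - B. marginal v (set es) e' \<le> marginal v (set es) e)))))"

end

theory Submission
  imports Defs
begin

text \<open>For a fixed agent, submodularity yields additive weights on each bundle of an MMS partition, of
  total \<open>1\<close>, that bound the valuation from below inside the bundle. Let \<open>D\<close> be the amount by which the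
  remaining weight of the heaviest \<open>n - t\<close> bundles falls short of \<open>n - t\<close>. A special round does not
  increase \<open>D\<close>; in a non-special round each item is drawn from a bucket of size \<open>4 (n - t)\<close>, so the
  expectation of \<open>5 powr D\<close> grows at most by the factor \<open>exp (4 (n - t) / (4 (n - t))) = e\<close>. Hence
  \<open>5 powr D\<close> divided by \<open>e\<close> to the number of non-special rounds is a supermartingale. If the agent
  ends up with value less than \<open>1/24\<close>, then summing marginal values over the buckets gives
  \<open>D \<ge> 5/8 (n - t)\<close>; since \<open>5/8 ln 5 \<ge> 1\<close> and at most \<open>n - t - card S\<close> rounds were non-special, the
  supermartingale is then at least \<open>exp (card S) \<ge> n\<^sup>2\<close>, which has probability at most \<open>1/n\<^sup>2\<close>. A
  union bound over the agents concludes.\<close>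

section \<open>Exponential moment of the draws in one non-special round\<close>

text \<open>Convexity puts the exponential below its chord on \<open>[0, 1]\<close>, so the mean of
  \<open>c powr f e\<close> over a bucket is bounded by an expression linear in
  \<open>f\<close>.\<close>

lemma powr_le_chord:
  fixes c x :: real
  assumes "1 \<le> c" "0 \<le> x" "x \<le> 1"
  shows "c powr x \<le> 1 + (c - 1) * x"
proof -
  have "exp ((1 - x) * 0 + x * ln c) \<le> (1 - x) * exp 0 + x * exp (ln c)"
    using convex_onD[OF exp_convex, of x 0 "ln c"] assms by simp
  then show ?thesis
    using assms by (simp add: powr_def algebra_simps)
qed

text \<open>A uniform draw from a bucket \<open>B\<close> of size \<open>s\<close> contributes a
  factor of mean at most \<open>1 + (c - 1) * sum f B / s\<close>, hence at most the exponential of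
  the second summand. The buckets are disjoint parts of \<open>G\<close>, so the exponents add up to
  at most the total for \<open>G\<close>, however the buckets depend on earlier draws.\<close>

lemma sample_loop_exp_moment:
  fixes f :: "nat \<Rightarrow> real" and c :: real
  assumes "1 \<le> c" "\<And>e. 0 \<le> f e" "\<And>e. f e \<le> 1" "finite G" "set es \<inter> G = {}"
  shows "(\<integral>\<^sup>+ es'. ennreal (c powr sum f (set es')) \<partial>sample_loop b s G es)
           \<le> ennreal (c powr sum f (set es) * exp ((c - 1) * sum f G / real s))"
  using assms(4,5)
proof (induction b s G es rule: sample_loop.induct)
  case (1 b s G es)
  show ?case
  proof (cases "s \<le> card G \<and> 0 < s \<and> b es G \<subseteq> G \<and> card (b es G) = s")
    case False
    then have "sample_loop b s G es = return_pmf es"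
      by (subst sample_loop.simps) auto
    moreover have "c powr sum f (set es) \<le> c powr sum f (set es) * exp ((c - 1) * sum f G / real s)"
      using assms(1,2) by (intro mult_le_cancel_left1[THEN iffD2]) (auto intro!: sum_nonneg divide_nonneg_nonneg mult_nonneg_nonneg)
    ultimately show ?thesis
      by (simp add: ennreal_leI)
  next
    case True
    define B where "B = b es G"
    have B: "B \<subseteq> G" "card B = s" "0 < s" "finite B" "B \<noteq> {}"
      using True 1(2) by (auto simp: B_def intro: finite_subset)
    define K where "K = c powr sum f (set es) * exp ((c - 1) * sum f (G - B) / real s)"
    have K: "0 \<le> K"
      by (simp add: K_def)
    have loop: "sample_loop b s G es =
        bind_pmf (pmf_of_set B) (\<lambda>e. sample_loop b s (G - B) (es @ [e]))"
      using True by (subst sample_loop.simps) (simp add: B_def)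
    have "(\<integral>\<^sup>+ es'. ennreal (c powr sum f (set es')) \<partial>sample_loop b s G es)
        = (\<integral>\<^sup>+ e. \<integral>\<^sup>+ es'. ennreal (c powr sum f (set es')) \<partial>sample_loop b s (G - B) (es @ [e])
             \<partial>pmf_of_set B)"
      unfolding loop by simp
    also have "\<dots> \<le> (\<integral>\<^sup>+ e. ennreal (K * c powr f e) \<partial>pmf_of_set B)"
    proof (intro nn_integral_mono_AE AE_pmfI)
      fix e assume "e \<in> set_pmf (pmf_of_set B)"
      then have e: "e \<in> B"
        using B by simp
      then have e': "e \<in> set_pmf (pmf_of_set (b es G))"
        using B by (simp add: B_def)
      have "(\<integral>\<^sup>+ es'. ennreal (c powr sum f (set es')) \<partial>sample_loop b s (G - B) (es @ [e]))
          \<le> ennreal (c powr sum f (set (es @ [e])) * exp ((c - 1) * sum f (G - B) / real s))"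
        unfolding B_def using True e' e 1(2,3) by (intro 1(1)) (auto simp: B_def)
      \<comment> \<open>Draws are summed as a set; \<open>e\<close> is new because \<open>B\<close>
        lies in \<open>G\<close>, which is disjoint from \<open>set es\<close>.\<close>
      moreover have "sum f (set (es @ [e])) = f e + sum f (set es)"
        using e B 1(3) by (subst set_append) (auto simp: sum.insert_if)
      ultimately show "(\<integral>\<^sup>+ es'. ennreal (c powr sum f (set es')) \<partial>sample_loop b s (G - B) (es @ [e]))
          \<le> ennreal (K * c powr f e)"
        by (simp add: K_def powr_add mult_ac)
    qed
    also have "\<dots> = ennreal ((\<Sum>e\<in>B. K * c powr f e) / s)"
      using B K by (subst nn_integral_pmf_of_set) (auto simp: sum_ennreal divide_ennreal sum_nonneg ennreal_of_nat_eq_real_of_nat)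
    also have "\<dots> \<le> ennreal (c powr sum f (set es) * exp ((c - 1) * sum f G / real s))"
    proof (rule ennreal_leI)
      have "(\<Sum>e\<in>B. c powr f e) \<le> (\<Sum>e\<in>B. 1 + (c - 1) * f e)"
        using assms by (intro sum_mono powr_le_chord) auto
      also have "\<dots> = s + (c - 1) * sum f B"
        using B by (simp add: sum.distrib sum_distrib_left)
      finally have "(\<Sum>e\<in>B. c powr f e) / s \<le> 1 + (c - 1) * sum f B / s"
        using B by (simp add: field_simps)
      also have "\<dots> \<le> exp ((c - 1) * sum f B / s)"
        by (rule exp_ge_add_one_self)
      finally have "K * ((\<Sum>e\<in>B. c powr f e) / s) \<le> K * exp ((c - 1) * sum f B / s)"
        using K by (rule mult_left_mono)
      also have "\<dots> = c powr sum f (set es) *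
          exp ((c - 1) * sum f (G - B) / s + (c - 1) * sum f B / s)"
        by (simp add: K_def exp_add mult_ac)
      also have "(c - 1) * sum f (G - B) / s + (c - 1) * sum f B / s = (c - 1) * sum f G / s"
        using B 1(2) by (simp add: sum.subset_diff[of B G f] field_simps)
      finally show "(\<Sum>e\<in>B. K * c powr f e) / s
          \<le> c powr sum f (set es) * exp ((c - 1) * sum f G / s)"
        by (simp add: sum_distrib_left)
    qed
    finally show ?thesis .
  qed
qed

section \<open>Marginal values under submodularity\<close>

lemma monotone_valuation_mono:
  assumes "monotone_valuation m v" "A \<subseteq> B" "B \<subseteq> {1..m}"
  shows "v A \<le> v B"
  using assms mono_onD[of "Pow {1..m}" v A B] by (simp add: monotone_valuation_def)

lemma marginal_nonneg:
  assumes "monotone_valuation m v" "A \<subseteq> {1..m}" "e \<in> {1..m}"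
  shows "0 \<le> marginal v A e"
  using monotone_valuation_mono[OF assms(1), of A "A \<union> {e}"] assms(2,3) by (auto simp: marginal_def)

text \<open>Submodularity for \<open>A \<union> {e}\<close> and \<open>A'\<close>. If
  \<open>e\<close> already lies in \<open>A'\<close>, its marginal there is zero and monotonicity is
  enough.\<close>

lemma marginal_antimono:
  assumes "monotone_valuation m v" "submodular m v"
    and "A \<subseteq> A'" "A' \<subseteq> {1..m}" "e \<in> {1..m}"
  shows "marginal v A' e \<le> marginal v A e"
proof (cases "e \<in> A'")
  case True
  then have "marginal v A' e = 0"
    by (simp add: marginal_def insert_absorb)
  moreover have "0 \<le> marginal v A e"
    using assms by (intro marginal_nonneg[of m]) auto
  ultimately show ?thesis
    by simp
next
  case False
  then have "(A \<union> {e}) \<union> A' = A' \<union> {e}" "(A \<union> {e}) \<inter> A' = A"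
    using assms(3) by auto
  moreover have "A \<union> {e} \<subseteq> {1..m}"
    using assms by blast
  then have "v ((A \<union> {e}) \<union> A') + v ((A \<union> {e}) \<inter> A') \<le> v (A \<union> {e}) + v A'"
    using assms(2,4) unfolding submodular_def by blast
  ultimately show ?thesis
    by (simp add: marginal_def)
qed

lemma value_le_sum_marginals:
  assumes "monotone_valuation m v" "submodular m v" "A \<subseteq> {1..m}" "X \<subseteq> {1..m}"
  shows "v (X \<union> A) \<le> v A + (\<Sum>e\<in>X. marginal v A e)"
proof -
  have "finite X"
    using assms(4) by (rule finite_subset) simp
  then show ?thesis
    using assms(4)
  proof (induction X)
    case (insert x X)
    have "marginal v (X \<union> A) x \<le> marginal v A x"
      using insert assms by (intro marginal_antimono[of m]) auto
    then show ?case
      using insert by (simp add: marginal_def)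
  qed simp
qed

section \<open>Additive weights below the valuation on the bundles of an MMS partition\<close>

text \<open>Greedy weights: items are inserted one by one and each receives its marginal value at
  insertion. An item's marginal over a subset of its predecessors is at least as large, which gives
  the bound for every \<open>T\<close>.\<close>

lemma submodular_supporting_weights:
  assumes "monotone_valuation m v" "submodular m v" "X \<subseteq> {1..m}"
  shows "\<exists>a. (\<forall>e. 0 \<le> a e) \<and> sum a X = v X - v {} \<and> (\<forall>T\<subseteq>X. v {} + sum a T \<le> v T)"
proof -
  have "finite X"
    using assms(3) by (rule finite_subset) simp
  then show ?thesis
    using assms(3)
  proof (induction X)
    case empty
    then show ?case
      by (intro exI[of _ "\<lambda>_. 0"]) auto
  next
    case (insert x X)
    then obtain a where a: "\<And>e. 0 \<le> a e" "sum a X = v X - v {}"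
      "\<And>T. T \<subseteq> X \<Longrightarrow> v {} + sum a T \<le> v T"
      by auto
    define a' where "a' = a(x := marginal v X x)"
    have eq: "sum a' T = sum a T" if "T \<subseteq> X" for T
      using that insert.hyps by (intro sum.cong) (auto simp: a'_def)
    have "0 \<le> marginal v X x"
      using insert.prems assms(1) by (intro marginal_nonneg[of m]) auto
    then have "0 \<le> a' e" for e
      using a(1) by (simp add: a'_def)
    moreover have "sum a' (insert x X) = v (insert x X) - v {}"
      using insert.hyps a(2) eq[of X] by (simp add: a'_def marginal_def)
    moreover have "v {} + sum a' T \<le> v T" if T: "T \<subseteq> insert x X" for T
    proof (cases "x \<in> T")
      case False
      then show ?thesis
        using T a(3)[of T] eq[of T] by (auto simp: subset_insert)
    next
      case True
      define T' where "T' = T - {x}"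
      have T': "T = insert x T'" "x \<notin> T'" "T' \<subseteq> X" "finite T'"
        using True T insert(1) finite_subset[of T' X] by (auto simp: T'_def)
      have "marginal v X x \<le> marginal v T' x"
        using insert.prems assms(1,2) T' by (intro marginal_antimono[of m]) auto
      moreover have "v {} + sum a T' \<le> v T'"
        using a(3) T' by blast
      ultimately show ?thesis
        using T' eq[of T'] by (simp add: a'_def marginal_def)
    qed
    ultimately show ?case
      by blast
  qed
qed

text \<open>The greedy weights are rescaled to total \<open>1\<close>. If \<open>v X - v {}\<close>
  is less than \<open>1\<close>, this enlarges them, and the value \<open>v {}\<close> of the empty
  set makes up for the increase.\<close>

lemma submodular_unit_weights:
  assumes "monotone_valuation m v" "submodular m v" "X \<subseteq> {1..m}" "1 \<le> v X" "v {} < 1"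
  shows "\<exists>w. (\<forall>e. 0 \<le> w e) \<and> sum w X = 1 \<and> (\<forall>T\<subseteq>X. sum w T \<le> v T)"
proof -
  obtain a where a: "\<And>e. 0 \<le> a e" "sum a X = v X - v {}"
    "\<And>T. T \<subseteq> X \<Longrightarrow> v {} + sum a T \<le> v T"
    using submodular_supporting_weights[OF assms(1-3)] by blast
  have c: "0 \<le> v {}"
    using assms(1) by (auto simp: monotone_valuation_def)
  define p where "p = v X - v {}"
  have p: "0 < p" "1 - v {} \<le> p"
    using assms by (auto simp: p_def)
  have fin: "finite X"
    using assms(3) by (rule finite_subset) simp
  define w where "w = (\<lambda>e. a e / p)"
  have w: "sum w T = sum a T / p" for T
    by (simp add: w_def sum_divide_distrib)
  have "sum w T \<le> v T" if T: "T \<subseteq> X" for T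
  proof -
    define y where "y = sum a T / p"
    have "sum a T \<le> p"
      using a(1,2) T fin by (auto simp: p_def intro: order.trans[OF sum_mono2])
    then have y: "0 \<le> y" "y \<le> 1"
      using p a(1) by (auto simp: y_def sum_nonneg)
    \<comment> \<open>The weight \<open>y\<close> of \<open>T\<close> is split as
      \<open>y * (1 - v {}) + y * v {}\<close>; the first part is at most \<open>sum a T\<close>,
      the second at most \<open>v {}\<close>.\<close>
    have "y * (1 - v {}) \<le> y * p"
      using y p by (intro mult_left_mono) auto
    moreover have "y * v {} \<le> 1 * v {}"
      using y c by (intro mult_right_mono) auto
    moreover have "y * p = sum a T"
      using p by (simp add: y_def)
    ultimately show ?thesis
      using a(3)[OF T] unfolding w y_def[symmetric] by (simp add: algebra_simps)
  qed
  then show ?thesis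
    using a(1,2) p w by (intro exI[of _ w]) (auto simp: w_def p_def)
qed

lemma MMS_partition_exists:
  assumes "1 \<le> n"
  shows "\<exists>P. bundle_partition n m P \<and> (\<forall>l\<in>{1..n}. MMS n m v \<le> v (P l))"
proof -
  let ?M = "{Min ((\<lambda>l. v (P l)) ` {1..n}) | P. bundle_partition n m P}"
  \<comment> \<open>Infinitely many functions \<open>P\<close> represent partitions, since they are
    arbitrary outside \<open>{1..n}\<close>; finiteness is therefore shown for the values.\<close>
  have "?M \<subseteq> v ` Pow {1..m}"
  proof safe
    fix P assume P: "bundle_partition n m P"
    have "Min ((\<lambda>l. v (P l)) ` {1..n}) \<in> (\<lambda>l. v (P l)) ` {1..n}"
      using assms by (intro Min_in) auto
    then obtain l where "l \<in> {1..n}" "Min ((\<lambda>l. v (P l)) ` {1..n}) = v (P l)"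
      by blast
    moreover have "P l \<subseteq> {1..m}"
      using P \<open>l \<in> {1..n}\<close> by (auto simp: bundle_partition_def)
    ultimately show "Min ((\<lambda>l. v (P l)) ` {1..n}) \<in> v ` Pow {1..m}"
      by auto
  qed
  then have "finite ?M"
    by (rule finite_subset) simp
  moreover have "bundle_partition n m (\<lambda>l. if l = 1 then {1..m} else {})"
    using assms by (auto simp: bundle_partition_def disjoint_family_on_def split: if_splits)
  then have "?M \<noteq> {}"
    by blast
  ultimately have "Max ?M \<in> ?M"
    by (rule Max_in)
  then obtain P where P: "bundle_partition n m P" "MMS n m v = Min ((\<lambda>l. v (P l)) ` {1..n})"
    by (auto simp: MMS_def)
  then have "\<forall>l\<in>{1..n}. MMS n m v \<le> v (P l)"
    by auto
  then show ?thesis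
    using P by blast
qed

lemma MMS_unit_weights:
  assumes "1 \<le> n" "monotone_valuation m v" "submodular m v" "1 \<le> MMS n m v" "v {} < 1"
  shows "\<exists>P w. bundle_partition n m P \<and> (\<forall>e. 0 \<le> w e) \<and>
    (\<forall>l\<in>{1..n}. sum w (P l) = 1 \<and> (\<forall>T\<subseteq>P l. sum w T \<le> v T))"
proof -
  obtain P where P: "bundle_partition n m P" "\<And>l. l \<in> {1..n} \<Longrightarrow> 1 \<le> v (P l)"
    using MMS_partition_exists[OF assms(1), of m v] assms(4) by fastforce
  have "\<exists>w. (\<forall>e. 0 \<le> w e) \<and> sum w (P l) = 1 \<and> (\<forall>T\<subseteq>P l. sum w T \<le> v T)" if "l \<in> {1..n}" for l
    using P that assms by (intro submodular_unit_weights[of m]) (auto simp: bundle_partition_def)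
  then obtain W where W: "\<And>l e. l \<in> {1..n} \<Longrightarrow> 0 \<le> W l e"
    "\<And>l. l \<in> {1..n} \<Longrightarrow> sum (W l) (P l) = 1"
    "\<And>l T. l \<in> {1..n} \<Longrightarrow> T \<subseteq> P l \<Longrightarrow> sum (W l) T \<le> v T"
    by metis
  \<comment> \<open>One weight function for all bundles: by disjointness only the bundle containing
    \<open>e\<close> contributes.\<close>
  define w where "w = (\<lambda>e. \<Sum>l\<in>{1..n}. if e \<in> P l then W l e else 0 :: real)"
  have eq: "sum w T = sum (W l) T" if l: "l \<in> {1..n}" "T \<subseteq> P l" for l T
  proof (rule sum.cong)
    fix e assume "e \<in> T"
    then have "e \<in> P l' \<longleftrightarrow> l' = l" if "l' \<in> {1..n}" for l'
      using P(1) l that unfolding bundle_partition_def disjoint_family_on_def by blast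
    then have "w e = (\<Sum>l'\<in>{1..n}. if l' = l then W l' e else 0)"
      unfolding w_def by (intro sum.cong) auto
    then show "w e = W l e"
      using l by simp
  qed simp
  have "0 \<le> w e" for e
    using W(1) by (auto simp: w_def intro!: sum_nonneg)
  then show ?thesis
    using P W eq by (intro exI[of _ P] exI[of _ w]) auto
qed

section \<open>The shortfall and its change in one round\<close>

definition bundle_choices :: "nat \<Rightarrow> nat \<Rightarrow> nat set set" where
  "bundle_choices n t = {U. U \<subseteq> {1..n} \<and> card U = n - t}"

text \<open>The maximum ranges over all choices of \<open>n - t\<close> bundles so that a special round never increases
  the shortfall: the bundle that loses an item may be dropped from the choice.\<close>

definition shortfall ::
    "nat \<Rightarrow> (nat \<Rightarrow> nat set) \<Rightarrow> (nat \<Rightarrow> real) \<Rightarrow> nat set \<Rightarrow> nat \<Rightarrow> real" where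
  "shortfall n P w R t =
     real (n - t) - Max ((\<lambda>U. sum w (R \<inter> \<Union>(P ` U))) ` bundle_choices n t)"

lemma finite_bundle_choices [simp]: "finite (bundle_choices n t)"
  by (rule finite_subset[of _ "Pow {1..n}"]) (auto simp: bundle_choices_def)

lemma bundle_choices_nonempty [simp]: "bundle_choices n t \<noteq> {}"
  using obtain_subset_with_card_n[of "n - t" "{1..n}"] by (auto simp: bundle_choices_def)

lemma shortfall_le:
  "U \<in> bundle_choices n t \<Longrightarrow> shortfall n P w R t \<le> real (n - t) - sum w (R \<inter> \<Union>(P ` U))"
  by (simp add: shortfall_def)

lemma shortfall_attained:
  "\<exists>U\<in>bundle_choices n t. shortfall n P w R t = real (n - t) - sum w (R \<inter> \<Union>(P ` U))"
proof -
  have "Max ((\<lambda>U. sum w (R \<inter> \<Union>(P ` U))) ` bundle_choices n t)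
      \<in> (\<lambda>U. sum w (R \<inter> \<Union>(P ` U))) ` bundle_choices n t"
    by (intro Max_in) auto
  then obtain U where "U \<in> bundle_choices n t"
    "Max ((\<lambda>U. sum w (R \<inter> \<Union>(P ` U))) ` bundle_choices n t) = sum w (R \<inter> \<Union>(P ` U))"
    by (elim imageE)
  then show ?thesis
    unfolding shortfall_def by (intro bexI[of _ U]) simp_all
qed

text \<open>One bundle is dropped from an optimal choice. This loses weight at most
  \<open>1\<close>, while the target \<open>n - t\<close> also falls by \<open>1\<close>.\<close>

lemma shortfall_special:
  assumes "t < n" "finite R" "\<And>e. 0 \<le> w e"
    and "\<And>l. l \<in> {1..n} \<Longrightarrow> finite (P l) \<and> sum w (P l) \<le> 1"
  shows "shortfall n P w (R - {e}) (Suc t) \<le> shortfall n P w R t"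
proof -
  obtain U where U: "U \<in> bundle_choices n t"
    "shortfall n P w R t = real (n - t) - sum w (R \<inter> \<Union>(P ` U))"
    by (rule bexE[OF shortfall_attained])
  then have "U \<noteq> {}" and sub: "U \<subseteq> {1..n}"
    using assms(1) by (auto simp: bundle_choices_def)
  \<comment> \<open>If no chosen bundle contains \<open>e\<close>, an arbitrary one is
    dropped.\<close>
  then obtain l where l: "l \<in> U" "(\<exists>l'\<in>U. e \<in> P l') \<longrightarrow> e \<in> P l"
    by blast
  let ?Q = "(R - {e}) \<inter> \<Union>(P ` (U - {l}))"
  have "U - {l} \<in> bundle_choices n (Suc t)"
    using U(1) l(1) finite_subset[OF sub] by (auto simp: bundle_choices_def)
  then have "shortfall n P w (R - {e}) (Suc t) \<le> real (n - Suc t) - sum w ?Q"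
    by (rule shortfall_le)
  moreover have "sum w (R \<inter> \<Union>(P ` U)) \<le> sum w ?Q + sum w (P l)"
  proof -
    have fin: "finite ?Q" "finite (P l)"
      using assms l sub by auto
    have "sum w (R \<inter> \<Union>(P ` U)) \<le> sum w (?Q \<union> P l)"
      using l fin assms(3) by (intro sum_mono2) auto
    also have "\<dots> \<le> sum w (?Q \<union> P l) + sum w (?Q \<inter> P l)"
      using assms(3) by (simp add: sum_nonneg)
    also have "\<dots> = sum w ?Q + sum w (P l)"
      using fin by (rule sum.union_inter)
    finally show ?thesis .
  qed
  moreover have "sum w (P l) \<le> 1"
    using assms(4) l sub by auto
  ultimately show ?thesis
    using U(2) assms(1) by (simp add: of_nat_diff)
qed

lemma sum_weights_bundles:
  assumes "bundle_partition n m P" "U \<subseteq> {1..n}" "finite R"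
  shows "sum w (R \<inter> \<Union>(P ` U)) = (\<Sum>l\<in>U. sum w (R \<inter> P l))"
proof -
  have "R \<inter> \<Union>(P ` U) = (\<Union>l\<in>U. R \<inter> P l)"
    by blast
  moreover have "(R \<inter> P l) \<inter> (R \<inter> P l') = {}" if "l \<in> U" "l' \<in> U" "l \<noteq> l'" for l l'
    using assms(1,2) that unfolding bundle_partition_def disjoint_family_on_def by blast
  moreover have "finite U"
    using assms(2) by (rule finite_subset) simp
  ultimately show ?thesis
    using assms(3) sum.UNION_disjoint[of U "\<lambda>l. R \<inter> P l" w] by simp
qed

text \<open>A choice \<open>U\<close> that is optimal before the round is kept fixed, and
  \<open>f\<close> is \<open>w\<close> restricted to its bundles. The total of \<open>f\<close> on
  \<open>R\<close> is at most \<open>n - t\<close>, so the exponential moment with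
  \<open>c = 5\<close> and bucket size \<open>4 * (n - t)\<close> has exponent at most
  \<open>1\<close>.\<close>

lemma sample_loop_shortfall:
  assumes P: "bundle_partition n m P" and w: "\<And>e. 0 \<le> w e"
    and P1: "\<And>l. l \<in> {1..n} \<Longrightarrow> sum w (P l) \<le> 1"
    and R: "finite R"
  shows "(\<integral>\<^sup>+ es. ennreal (5 powr shortfall n P w (R - set es) t) \<partial>sample_loop b (4 * (n - t)) R [])
           \<le> ennreal (5 powr shortfall n P w R t * exp 1)"
proof -
  obtain U where U: "U \<in> bundle_choices n t"
    "shortfall n P w R t = real (n - t) - sum w (R \<inter> \<Union>(P ` U))"
    by (rule bexE[OF shortfall_attained])
  have sub: "U \<subseteq> {1..n}"
    using U(1) by (simp add: bundle_choices_def)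
  have finP: "finite (P l)" if "l \<in> {1..n}" for l
    using P that by (intro finite_subset[of "P l" "{1..m}"]) (auto simp: bundle_partition_def)
  define f where "f = (\<lambda>e. if e \<in> \<Union>(P ` U) then w e else 0)"
  have f_sum: "sum f X = sum w (X \<inter> \<Union>(P ` U))" if "finite X" for X
    using that by (simp add: f_def sum.inter_restrict)
  have f0: "0 \<le> f e" for e
    using w by (simp add: f_def)
  have f1: "f e \<le> 1" for e
  proof (cases "e \<in> \<Union>(P ` U)")
    case True
    then obtain l where l: "l \<in> {1..n}" "e \<in> P l"
      using sub by auto
    have "w e \<le> sum w (P l)"
      using l w finP by (intro member_le_sum) auto
    then show ?thesis
      using P1[OF l(1)] True by (simp add: f_def)
  qed (simp add: f_def)
  have "sum f R = (\<Sum>l\<in>U. sum w (R \<inter> P l))"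
    using R sub P by (simp add: f_sum sum_weights_bundles)
  also have "\<dots> \<le> (\<Sum>l\<in>U. 1)"
  proof (rule sum_mono)
    fix l assume "l \<in> U"
    then have "sum w (R \<inter> P l) \<le> sum w (P l)"
      using sub finP w by (intro sum_mono2) auto
    then show "sum w (R \<inter> P l) \<le> 1"
      using P1 \<open>l \<in> U\<close> sub by fastforce
  qed
  finally have fR: "sum f R \<le> real (n - t)"
    using U(1) by (simp add: bundle_choices_def)
  \<comment> \<open>\<open>U\<close> remains admissible after the draws, though perhaps no longer
    optimal, so the shortfall grows by at most the weight drawn from it.\<close>
  have step: "shortfall n P w (R - set es) t \<le> shortfall n P w R t + sum f (set es)" for es
  proof -
    have "shortfall n P w (R - set es) t \<le> real (n - t) - sum f (R - set es)"
      using shortfall_le[OF U(1)] R by (simp add: f_sum)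
    moreover have "sum f R \<le> sum f ((R - set es) \<union> set es)"
      using R f0 by (intro sum_mono2) auto
    moreover have "sum f ((R - set es) \<union> set es) = sum f (R - set es) + sum f (set es)"
      using R by (intro sum.union_disjoint) auto
    ultimately show ?thesis
      using U(2) R by (simp add: f_sum)
  qed
  let ?C = "5 powr shortfall n P w R t :: real"
  have "(\<integral>\<^sup>+ es. ennreal (5 powr shortfall n P w (R - set es) t) \<partial>sample_loop b (4 * (n - t)) R [])
      \<le> (\<integral>\<^sup>+ es. ennreal ?C * ennreal (5 powr sum f (set es)) \<partial>sample_loop b (4 * (n - t)) R [])"
    using step by (intro nn_integral_mono)
      (auto simp: ennreal_mult[symmetric] powr_add[symmetric] intro!: ennreal_leI)
  also have "\<dots> = ennreal ?C * (\<integral>\<^sup>+ es. ennreal (5 powr sum f (set es)) \<partial>sample_loop b (4 * (n - t)) R [])"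
    by (rule nn_integral_cmult) simp
  also have "\<dots> \<le> ennreal ?C * ennreal (5 powr sum f (set []) * exp ((5 - 1) * sum f R / real (4 * (n - t))))"
    using R f0 f1 by (intro mult_left_mono sample_loop_exp_moment) auto
  \<comment> \<open>The factor \<open>5 - 1\<close> cancels the \<open>4\<close> of the bucket size;
    for \<open>n \<le> t\<close> the quotient is \<open>0\<close> by convention.\<close>
  also have "\<dots> \<le> ennreal ?C * ennreal (exp 1)"
    using fR by (intro mult_left_mono ennreal_leI) (auto simp: divide_le_eq_1 split: if_splits)
  also have "\<dots> = ennreal (?C * exp 1)"
    by (simp add: ennreal_mult)
  finally show ?thesis .
qed

section \<open>The supermartingale\<close>

lemma card_atLeastAtMost_Suc_Diff:
  "card ({1..Suc i} - S) = (if Suc i \<in> S then 0 else 1) + card ({1..i} - S)"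
proof -
  have "{1..Suc i} = insert (Suc i) {1..i}"
    by (simp add: atLeastAtMostSuc_conv)
  then show ?thesis
    by (simp add: insert_Diff_if del: One_nat_def)
qed

text \<open>Supplies \<open>t < n\<close> at every arrival, the range in which
  \<open>safe_strategy\<close> prescribes the behaviour.\<close>

lemma state_invariant:
  assumes "(R, t, A) \<in> set_pmf (single_or_sample_state k n m S \<sigma> i)"
  shows "R \<subseteq> {1..m} \<and> t \<le> card ({1..i} - S)"
  using assms
proof (induction i arbitrary: R t A)
  case (Suc i)
  note card = card_atLeastAtMost_Suc_Diff[of i S]
  obtain R' t' A' where st: "(R', t', A') \<in> set_pmf (single_or_sample_state k n m S \<sigma> i)"
    "(R, t, A) \<in> set_pmf (if Suc i \<in> S then return_pmf (R', t', A')
       else agent_round k n \<sigma> (Suc i) (R', t', A'))"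
    using Suc.prems by auto
  have "R \<subseteq> R' \<and> t \<le> t' + (if Suc i \<in> S then 0 else 1)"
    using st(2) by (auto simp: agent_round_def split: if_splits option.splits)
  then show ?case
    using Suc.IH[OF st(1)] card by auto
qed simp

text \<open>The exponent \<open>t - card ({1..i} - S)\<close> is minus the number of non-special rounds so far; one
  non-special round multiplies the expectation of the first factor by at most \<open>e\<close>.\<close>

definition potential ::
    "nat \<Rightarrow> nat set \<Rightarrow> (nat \<Rightarrow> nat set) \<Rightarrow> (nat \<Rightarrow> real) \<Rightarrow> nat \<Rightarrow> state \<Rightarrow> real" where
  "potential n S P w i = (\<lambda>(R, t, A).
     5 powr shortfall n P w R t * exp (real t - real (card ({1..i} - S))))"

text \<open>At the start all \<open>n\<close> bundles have weight \<open>1\<close>, so the shortfall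
  is at most \<open>0\<close>. A skipped agent changes neither factor. A special round raises
  \<open>t\<close> and the number of served agents alike and does not raise the shortfall. In a
  non-special round the second factor drops by \<open>e\<close>, which pays for the growth of the
  first.\<close>

lemma potential_supermartingale:
  assumes P: "bundle_partition n m P" and w: "\<And>e. 0 \<le> w e"
    and P1: "\<And>l. l \<in> {1..n} \<Longrightarrow> sum w (P l) = 1"
    and "i \<le> n"
  shows "(\<integral>\<^sup>+ st. ennreal (potential n S P w i st) \<partial>single_or_sample_state 4 n m S \<sigma> i) \<le> 1"
  using \<open>i \<le> n\<close>
proof (induction i)
  case 0
  have "shortfall n P w {1..m} 0 \<le> real (n - 0) - sum w ({1..m} \<inter> \<Union>(P ` {1..n}))"
    by (rule shortfall_le) (simp add: bundle_choices_def)
  also have "sum w ({1..m} \<inter> \<Union>(P ` {1..n})) = (\<Sum>l\<in>{1..n}. sum w ({1..m} \<inter> P l))"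
    using P by (intro sum_weights_bundles) auto
  also have "\<dots> = (\<Sum>l\<in>{1..n}. 1)"
  proof (rule sum.cong)
    fix l assume l: "l \<in> {1..n}"
    then have "{1..m} \<inter> P l = P l"
      using P by (auto simp: bundle_partition_def)
    then show "sum w ({1..m} \<inter> P l) = 1"
      using P1 l by simp
  qed simp
  finally have "shortfall n P w {1..m} 0 \<le> 0"
    by simp
  then have "(5::real) powr shortfall n P w {1..m} 0 \<le> 5 powr 0"
    by (intro powr_mono) auto
  then show ?case
    by (simp add: potential_def)
next
  case (Suc i)
  let ?q = "\<lambda>i. card ({1..i} - S)"
  have finP: "finite (P l)" if "l \<in> {1..n}" for l
    using P that by (intro finite_subset[of "P l" "{1..m}"]) (auto simp: bundle_partition_def)
  note card = card_atLeastAtMost_Suc_Diff[of i S]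
  have "(\<integral>\<^sup>+ st. ennreal (potential n S P w (Suc i) st) \<partial>single_or_sample_state 4 n m S \<sigma> (Suc i))
      = (\<integral>\<^sup>+ st. \<integral>\<^sup>+ st'. ennreal (potential n S P w (Suc i) st')
           \<partial>(if Suc i \<in> S then return_pmf st else agent_round 4 n \<sigma> (Suc i) st)
           \<partial>single_or_sample_state 4 n m S \<sigma> i)"
    by simp
  also have "\<dots> \<le> (\<integral>\<^sup>+ st. ennreal (potential n S P w i st) \<partial>single_or_sample_state 4 n m S \<sigma> i)"
  proof (intro nn_integral_mono_AE AE_pmfI)
    fix st assume st: "st \<in> set_pmf (single_or_sample_state 4 n m S \<sigma> i)"
    obtain R t A where st_eq: "st = (R, t, A)"
      by (cases st)
    have inv: "R \<subseteq> {1..m}" "t \<le> ?q i"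
      using state_invariant st st_eq by blast+
    have R: "finite R"
      using inv(1) by (rule finite_subset) simp
    have "?q i \<le> card {1..i}"
      by (intro card_mono) auto
    then have t: "t < n"
      using inv(2) Suc.prems by simp
    show "(\<integral>\<^sup>+ st'. ennreal (potential n S P w (Suc i) st')
           \<partial>(if Suc i \<in> S then return_pmf st else agent_round 4 n \<sigma> (Suc i) st))
        \<le> ennreal (potential n S P w i st)"
    proof (cases "Suc i \<in> S")
      case True
      then show ?thesis
        using card by (simp add: potential_def)
    next
      case False
      show ?thesis
      proof (cases "select (\<sigma> (Suc i)) R t")
        case (Some e)
        have "shortfall n P w (R - {e}) (Suc t) \<le> shortfall n P w R t"
          using t R w P1 finP by (intro shortfall_special) auto
        then have "(5::real) powr shortfall n P w (R - {e}) (Suc t) \<le> 5 powr shortfall n P w R t"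
          by (intro powr_mono) auto
        then show ?thesis
          using False Some card st_eq
          by (auto simp: potential_def agent_round_def intro!: ennreal_leI)
      next
        case None
        let ?E = "exp (real t - real (?q (Suc i)))"
        let ?L = "sample_loop (bucket (\<sigma> (Suc i)) R t) (4 * (n - t)) R []"
        have "(\<integral>\<^sup>+ st'. ennreal (potential n S P w (Suc i) st') \<partial>agent_round 4 n \<sigma> (Suc i) st)
            = (\<integral>\<^sup>+ es. ennreal (5 powr shortfall n P w (R - set es) t) * ennreal ?E \<partial>?L)"
          using None st_eq by (simp add: potential_def agent_round_def ennreal_mult)
        also have "\<dots> = (\<integral>\<^sup>+ es. ennreal (5 powr shortfall n P w (R - set es) t) \<partial>?L) * ennreal ?E"
          by (rule nn_integral_multc) simp
        also have "\<dots> \<le> ennreal (5 powr shortfall n P w R t * exp 1) * ennreal ?E"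
          using P w P1 R by (intro mult_right_mono sample_loop_shortfall) auto
        also have "\<dots> = ennreal (potential n S P w i st)"
          using False card st_eq
          by (simp add: potential_def ennreal_mult[symmetric] exp_add[symmetric] mult.assoc)
        finally show ?thesis
          using False by simp
      qed
    qed
  qed
  also have "\<dots> \<le> 1"
    using Suc by simp
  finally show ?case .
qed

section \<open>Consequences of a low value for an agent with the safe strategy\<close>

text \<open>By the choice of the buckets, the marginals in one bucket are bounded by the marginal of the
  item drawn from the previous one; \<open>M\<close> bounds those in the first bucket.\<close>

lemma sample_loop_sum_marginals:
  assumes v: "monotone_valuation m v" "submodular m v" and R: "R \<subseteq> {1..m}" and s: "0 < s"
    and b: "\<And>es G. \<lbrakk>G \<subseteq> R; set es \<subseteq> R - G; s \<le> card G\<rbrakk> \<Longrightarrow>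
      b es G \<subseteq> G \<and> card (b es G) = s \<and>
      (\<forall>e\<in>b es G. \<forall>e'\<in>G - b es G. marginal v (set es) e' \<le> marginal v (set es) e)"
    and "G \<subseteq> R" "set es \<subseteq> R - G" "0 \<le> M" "\<And>e. e \<in> G \<Longrightarrow> marginal v (set es) e \<le> M"
    and "es' \<in> set_pmf (sample_loop b s G es)"
  shows "set es \<subseteq> set es' \<and> set es' \<subseteq> R \<and>
    (\<Sum>e\<in>G. marginal v (set es') e) \<le> s * M + s * (v (set es') - v (set es))"
  using assms(6-)
proof (induction "card G" arbitrary: G es M rule: less_induct)
  case less
  note GR = less.prems(1) and esR = less.prems(2) and M = less.prems(3,4) and es' = less.prems(5)
  have "finite R"
    using R by (rule finite_subset) simp
  then have fin: "finite G"
    using GR by (rule rev_finite_subset)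
  show ?case
  proof (cases "s \<le> card G")
    case False
    then have "sample_loop b s G es = return_pmf es"
      by (subst sample_loop.simps) simp
    \<comment> \<open>The loop stops with fewer than \<open>s\<close> items left, each of marginal
      at most \<open>M\<close>; no more value is gained.\<close>
    then have "es' = es"
      using es' by simp
    moreover have "(\<Sum>e\<in>G. marginal v (set es) e) \<le> (\<Sum>e\<in>G. M)"
      using M(2) by (rule sum_mono)
    moreover have "card G * M \<le> s * M"
      using False M(1) by (intro mult_right_mono) auto
    ultimately show ?thesis
      using esR by auto
  next
    case True
    define B where "B = b es G"
    have B: "B \<subseteq> G" "card B = s"
      "\<And>e e'. e \<in> B \<Longrightarrow> e' \<in> G - B \<Longrightarrow> marginal v (set es) e' \<le> marginal v (set es) e"
      using b[OF GR esR True] unfolding B_def by auto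
    have finB: "finite B" "B \<noteq> {}"
      using B s fin by (auto intro: finite_subset)
    have "s \<le> card G \<and> 0 < s \<and> b es G \<subseteq> G \<and> card (b es G) = s"
      using B True s by (simp add: B_def)
    then have "sample_loop b s G es =
        bind_pmf (pmf_of_set B) (\<lambda>e. sample_loop b s (G - B) (es @ [e]))"
      by (subst sample_loop.simps) (simp add: B_def)
    then obtain e where e: "e \<in> B" "es' \<in> set_pmf (sample_loop b s (G - B) (es @ [e]))"
      using es' finB by auto
    let ?M = "marginal v (set es) e"
    have set_es: "set es \<subseteq> {1..m}" "e \<in> {1..m}" "G \<subseteq> {1..m}"
      using GR esR R e(1) B(1) by blast+
    \<comment> \<open>The induction hypothesis is used with the marginal of the drawn item in place
      of \<open>M\<close>: no item outside the bucket has a larger marginal, and by submodularity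
      the draw does not change this.\<close>
    have "set (es @ [e]) \<subseteq> set es' \<and> set es' \<subseteq> R \<and>
      (\<Sum>e\<in>G - B. marginal v (set es') e) \<le> s * ?M + s * (v (set es') - v (set (es @ [e])))"
    proof (rule less.hyps)
      show "card (G - B) < card G"
        using B(1) finB fin by (intro psubset_card_mono) auto
      show "G - B \<subseteq> R" "set (es @ [e]) \<subseteq> R - (G - B)"
        using GR esR e(1) B(1) by auto
      show "0 \<le> ?M"
        using v set_es by (intro marginal_nonneg[of m]) auto
      show "es' \<in> set_pmf (sample_loop b s (G - B) (es @ [e]))"
        by (rule e(2))
      fix e' assume e': "e' \<in> G - B"
      have "marginal v (set (es @ [e])) e' \<le> marginal v (set es) e'"
        using e' set_es v by (intro marginal_antimono[of m]) auto
      then show "marginal v (set (es @ [e])) e' \<le> ?M"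
        using B(3)[OF e(1) e'] by simp
    qed
    \<comment> \<open>The draw gains exactly this marginal, so the term \<open>s * ?M\<close> is
      absorbed and the bound telescopes.\<close>
    moreover have "v (set (es @ [e])) = v (set es) + ?M"
      by (simp add: marginal_def)
    ultimately have IH: "set es \<subseteq> set es'" "set es' \<subseteq> R"
      "(\<Sum>e\<in>G - B. marginal v (set es') e) \<le> s * (v (set es') - v (set es))"
      by (auto simp: algebra_simps)
    have "(\<Sum>e\<in>B. marginal v (set es') e) \<le> (\<Sum>e\<in>B. M)"
    proof (rule sum_mono)
      fix e' assume e': "e' \<in> B"
      have "marginal v (set es') e' \<le> marginal v (set es) e'"
        using IH e' B(1) R set_es v by (intro marginal_antimono[of m]) auto
      then show "marginal v (set es') e' \<le> M"
        using M(2)[of e'] e' B(1) by auto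
    qed
    then have "(\<Sum>e\<in>B. marginal v (set es') e) \<le> s * M"
      using B(2) by simp
    then show ?thesis
      using IH B(1) fin by (simp add: sum.subset_diff[of B G])
  qed
qed

lemma safe_strategy_special:
  assumes "safe_strategy k n m \<tau> v s" "R \<subseteq> {1..m}" "t < n" "e \<in> R" "\<tau> \<le> v {e}"
  shows "\<exists>e'. select s R t = Some e' \<and> \<tau> \<le> v {e'}"
proof -
  have "\<exists>e\<in>R. \<tau> \<le> v {e}"
    using assms(4,5) by blast
  then have "\<exists>e'\<in>R. select s R t = Some e' \<and> (\<forall>e''\<in>R. v {e''} \<le> v {e'})"
    using assms(1-3) unfolding safe_strategy_def by presburger
  then show ?thesis
    using assms(4,5) order.trans by blast
qed

lemma safe_strategy_non_special:
  assumes "safe_strategy k n m \<tau> v s" "R \<subseteq> {1..m}" "t < n" "\<And>e. e \<in> R \<Longrightarrow> v {e} < \<tau>"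
  shows "select s R t = None"
    and "\<And>es G. \<lbrakk>G \<subseteq> R; set es \<subseteq> R - G; k * (n - t) \<le> card G\<rbrakk> \<Longrightarrow>
      bucket s R t es G \<subseteq> G \<and> card (bucket s R t es G) = k * (n - t) \<and>
      (\<forall>e\<in>bucket s R t es G. \<forall>e'\<in>G - bucket s R t es G.
        marginal v (set es) e' \<le> marginal v (set es) e)"
proof -
  have "\<not> (\<exists>e\<in>R. \<tau> \<le> v {e})"
    using assms(4) not_le by blast
  then have none: "select s R t = None \<and> (\<forall>es G. G \<subseteq> R \<longrightarrow> set es \<subseteq> R - G \<longrightarrow> k * (n - t) \<le> card G \<longrightarrow>
      (let B = bucket s R t es G in B \<subseteq> G \<and> card B = k * (n - t) \<and>
        (\<forall>e\<in>B. \<forall>e'\<in>G - B. marginal v (set es) e' \<le> marginal v (set es) e)))"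
    using assms(1-3) unfolding safe_strategy_def by presburger
  then show "select s R t = None"
    by (rule conjunct1)
  fix es G assume "G \<subseteq> R" "set es \<subseteq> R - G" "k * (n - t) \<le> card G"
  then show "bucket s R t es G \<subseteq> G \<and> card (bucket s R t es G) = k * (n - t) \<and>
      (\<forall>e\<in>bucket s R t es G. \<forall>e'\<in>G - bucket s R t es G.
        marginal v (set es) e' \<le> marginal v (set es) e)"
    using none unfolding Let_def by blast
qed

text \<open>A value below \<open>\<tau>\<close> rules out a special round, so every remaining item
  is worth less than \<open>\<tau>\<close>. Hence the first bucket and the value gained in the loop
  each account for at most \<open>k * (n - t) * \<tau>\<close>.\<close>

lemma low_value_marginals:
  assumes v: "monotone_valuation m v" "submodular m v" "safe_strategy k n m \<tau> v (\<sigma> i)"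
    and R: "R \<subseteq> {1..m}" and "t < n" "0 < k" "0 \<le> \<tau>"
    and round: "(R', t', A') \<in> set_pmf (agent_round k n \<sigma> i (R, t, A))"
    and low: "v (A' i) < \<tau>"
  shows "A' i \<subseteq> R \<and> (\<Sum>e\<in>R. marginal v (A' i) e) \<le> 2 * real k * \<tau> * real (n - t)"
proof -
  have small: "v {e} < \<tau>" if "e \<in> R" for e
  proof (rule ccontr)
    assume "\<not> v {e} < \<tau>"
    then obtain e' where "select (\<sigma> i) R t = Some e'" "\<tau> \<le> v {e'}"
      using safe_strategy_special[OF v(3) R \<open>t < n\<close> \<open>e \<in> R\<close>] by auto
    then have "\<tau> \<le> v (A' i)"
      using round by (simp add: agent_round_def)
    then show False
      using low by simp
  qed
  let ?b = "bucket (\<sigma> i) R t"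
  let ?s = "k * (n - t)"
  note none = safe_strategy_non_special(1)[OF v(3) R \<open>t < n\<close> small]
  note b = safe_strategy_non_special(2)[OF v(3) R \<open>t < n\<close> small]
  obtain es where es: "es \<in> set_pmf (sample_loop ?b ?s R [])" "A' i = set es"
    using round none by (auto simp: agent_round_def)
  have empty: "0 \<le> v {}"
    using v(1) by (auto simp: monotone_valuation_def)
  have main: "set [] \<subseteq> set es \<and> set es \<subseteq> R \<and>
    (\<Sum>e\<in>R. marginal v (set es) e) \<le> ?s * \<tau> + ?s * (v (set es) - v (set []))"
  proof (rule sample_loop_sum_marginals[OF v(1,2) R _ b])
    show "0 < ?s"
      using \<open>0 < k\<close> \<open>t < n\<close> by simp
    fix e assume "e \<in> R"
    then show "marginal v (set []) e \<le> \<tau>"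
      using small[of e] empty by (simp add: marginal_def)
  qed (use \<open>0 \<le> \<tau>\<close> es(1) in auto)
  have "real ?s * (v (set es) - v {}) \<le> ?s * \<tau>"
    using low es(2) empty by (intro mult_left_mono) auto
  then show ?thesis
    using main es(2) by (simp add: mult_ac)
qed

text \<open>For each of the \<open>n - t\<close> chosen bundles the remaining weight is at most
  \<open>\<tau>\<close> plus the marginals of its items over the received set. The bundles are
  disjoint, so \<open>low_value_marginals\<close> bounds all these marginals together.\<close>

lemma low_value_imp_shortfall:
  assumes v: "monotone_valuation m v" "submodular m v" "safe_strategy k n m \<tau> v (\<sigma> i)"
    and P: "bundle_partition n m P" and wv: "\<And>l T. l \<in> {1..n} \<Longrightarrow> T \<subseteq> P l \<Longrightarrow> sum w T \<le> v T"
    and R: "R \<subseteq> {1..m}" and "t < n" "0 < k" "0 \<le> \<tau>"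
    and round: "(R', t', A') \<in> set_pmf (agent_round k n \<sigma> i (R, t, A))"
    and low: "v (A' i) < \<tau>"
  shows "(1 - (2 * real k + 1) * \<tau>) * real (n - t) \<le> shortfall n P w R t"
proof -
  have finR: "finite R"
    using R by (rule finite_subset) simp
  have marginals: "A' i \<subseteq> R" "(\<Sum>e\<in>R. marginal v (A' i) e) \<le> 2 * real k * \<tau> * real (n - t)"
    using low_value_marginals[of m v k n \<tau> \<sigma> i R t R' t' A' A] assms by auto
  then have A: "A' i \<subseteq> {1..m}"
    using R by auto
  obtain U where U: "U \<in> bundle_choices n t"
    "shortfall n P w R t = real (n - t) - sum w (R \<inter> \<Union>(P ` U))"
    by (rule bexE[OF shortfall_attained])
  then have sub: "U \<subseteq> {1..n}" and card: "card U = n - t"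
    by (auto simp: bundle_choices_def)
  have "sum w (R \<inter> \<Union>(P ` U)) = (\<Sum>l\<in>U. sum w (R \<inter> P l))"
    using P sub finR by (rule sum_weights_bundles)
  also have "\<dots> \<le> (\<Sum>l\<in>U. \<tau> + (\<Sum>e\<in>R \<inter> P l. marginal v (A' i) e))"
  proof (rule sum_mono)
    fix l assume "l \<in> U"
    then have "sum w (R \<inter> P l) \<le> v (R \<inter> P l)"
      using sub by (intro wv[of l]) auto
    also have "\<dots> \<le> v ((R \<inter> P l) \<union> A' i)"
      using R A by (intro monotone_valuation_mono[OF v(1)]) auto
    also have "\<dots> \<le> v (A' i) + (\<Sum>e\<in>R \<inter> P l. marginal v (A' i) e)"
      using R A by (intro value_le_sum_marginals[OF v(1,2)]) auto
    finally show "sum w (R \<inter> P l) \<le> \<tau> + (\<Sum>e\<in>R \<inter> P l. marginal v (A' i) e)"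
      using low by simp
  qed
  also have "\<dots> = (n - t) * \<tau> + (\<Sum>e\<in>R \<inter> \<Union>(P ` U). marginal v (A' i) e)"
    using P sub finR card by (simp add: sum.distrib sum_weights_bundles)
  also have "(\<Sum>e\<in>R \<inter> \<Union>(P ` U). marginal v (A' i) e) \<le> (\<Sum>e\<in>R. marginal v (A' i) e)"
    using finR R A v by (intro sum_mono2 marginal_nonneg[of m]) auto
  also note marginals(2)
  finally show ?thesis
    using U(2) by (simp add: algebra_simps)
qed

section \<open>Probability that a single agent is left with a low value\<close>

text \<open>With this constant a shortfall of \<open>5/8 * (n - t)\<close> makes
  \<open>5 powr\<close> of it at least \<open>exp (n - t)\<close>. The claim reduces to
  \<open>2.72 ^ 8 \<le> 5 ^ 5\<close>.\<close>

lemma ln_5_ge: "8 / 5 \<le> ln (5 :: real)"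
proof -
  have "exp (8 / 5 :: real) ^ 5 = exp 1 ^ 8"
    by (simp flip: exp_of_nat_mult)
  also have "\<dots> \<le> (272 / 100) ^ 8"
    using e_less_272 by (intro power_mono) auto
  also have "\<dots> \<le> 5 ^ 5"
    by (simp add: power_divide)
  finally have "exp (8 / 5 :: real) \<le> 5"
    \<comment> \<open>The rule compares powers with exponent \<open>Suc n\<close>, so
      \<open>4\<close> stands for the fifth power.\<close>
    using power_le_imp_le_base[of "exp (8 / 5)" 4 "5 :: real"] by simp
  then show ?thesis
    by (subst ln_ge_iff) auto
qed

lemma agent_low_value_at_arrival:
  assumes n: "1 \<le> n" and v: "monotone_valuation m v" "submodular m v" "1 \<le> MMS n m v"
    and S: "S \<subseteq> {1..n}" "2 * ln (real n) \<le> card S"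
    and i: "i \<in> {1..n} - S" and safe: "safe_strategy 4 n m (1 / 24) v (\<sigma> i)"
  shows "emeasure (single_or_sample_state 4 n m S \<sigma> i) {(R, t, A). v (A i) < 1 / 24}
    \<le> ennreal (1 / (real n)\<^sup>2)"
proof -
  obtain i' where i': "i = Suc i'" "i' < n"
    using i by (cases i) auto
  let ?low = "{(R, t, A). v (A i) < 1 / 24} :: state set"
  let ?\<mu> = "single_or_sample_state 4 n m S \<sigma> i'"
  have inv: "R \<subseteq> {1..m} \<and> t \<le> card ({1..i'} - S) \<and> t < n"
    if "(R, t, A) \<in> set_pmf ?\<mu>" for R t A
  proof -
    have "card ({1..i'} - S) \<le> card {1..i'}"
      by (intro card_mono) auto
    then show ?thesis
      using state_invariant[OF that] i'(2) by simp
  qed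
  \<comment> \<open>A test function for Markov's inequality: mean at most \<open>1\<close>, and at
    least \<open>n^2\<close> wherever the agent can end up with a low value.\<close>
  obtain \<Psi> where \<Psi>: "(\<integral>\<^sup>+ st. ennreal (\<Psi> st) \<partial>?\<mu>) \<le> 1"
    "\<And>st st'. \<lbrakk>st \<in> set_pmf ?\<mu>; st' \<in> set_pmf (agent_round 4 n \<sigma> i st); st' \<in> ?low\<rbrakk>
      \<Longrightarrow> (real n)\<^sup>2 \<le> \<Psi> st"
  proof (cases "1 \<le> v {}")
    case True
    show ?thesis
    \<comment> \<open>Monotonicity gives every bundle value at least \<open>v {}\<close>, so a low
      value is impossible and the second condition holds vacuously.\<close>
    proof (rule that[of "\<lambda>_. 0"])
      fix st st' assume st: "st \<in> set_pmf ?\<mu>" "st' \<in> set_pmf (agent_round 4 n \<sigma> i st)" "st' \<in> ?low"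
      obtain R t A R' t' A' where eq: "st = (R, t, A)" "st' = (R', t', A')"
        by (cases st, cases st')
      have "R \<subseteq> {1..m}" "t < n"
        using inv st(1) eq by blast+
      moreover from this have "A' i \<subseteq> R"
        using low_value_marginals[of m v 4 n "1 / 24" \<sigma> i R t R' t' A' A] v safe st eq by auto
      ultimately have "v {} \<le> v (A' i)"
        by (intro monotone_valuation_mono[OF v(1)]) auto
      then show "(real n)\<^sup>2 \<le> 0"
        using True st(3) eq by simp
    qed simp
  next
    case False
    then have "v {} < 1"
      by simp
    from MMS_unit_weights[OF n v this] obtain P w where P: "bundle_partition n m P"
      and w: "\<And>e. 0 \<le> w e" and P1: "\<And>l. l \<in> {1..n} \<Longrightarrow> sum w (P l) = 1"
      and wv: "\<And>l T. l \<in> {1..n} \<Longrightarrow> T \<subseteq> P l \<Longrightarrow> sum w T \<le> v T"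
      by blast
    show ?thesis
    proof (rule that[of "potential n S P w i'"])
      show "(\<integral>\<^sup>+ st. ennreal (potential n S P w i' st) \<partial>?\<mu>) \<le> 1"
        using P w P1 i' by (intro potential_supermartingale) auto
      fix st st' assume st: "st \<in> set_pmf ?\<mu>" "st' \<in> set_pmf (agent_round 4 n \<sigma> i st)" "st' \<in> ?low"
      obtain R t A R' t' A' where eq: "st = (R, t, A)" "st' = (R', t', A')"
        by (cases st, cases st')
      have Rt: "R \<subseteq> {1..m}" "t < n"
        using inv st(1) eq by blast+
      have "(1 - (2 * real 4 + 1) * (1 / 24)) * real (n - t) \<le> shortfall n P w R t"
        using Rt st eq by (intro low_value_imp_shortfall[where \<sigma> = \<sigma> and i = i and R' = R' and t' = t' and A' = A' and A = A,
            OF v(1,2) safe P wv]) auto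
      \<comment> \<open>With \<open>k = 4\<close> and \<open>\<tau> = 1/24\<close> the factor is
        \<open>1 - 9/24\<close>.\<close>
      then have D: "5 / 8 * real (n - t) \<le> shortfall n P w R t"
        by simp
      have "real (n - t) = 8 / 5 * (5 / 8 * real (n - t))"
        by simp
      also have "\<dots> \<le> ln 5 * shortfall n P w R t"
        using D ln_5_ge by (intro mult_mono) auto
      finally have exp_le: "exp (real (n - t)) \<le> 5 powr shortfall n P w R t"
        by (simp add: powr_def mult.commute)
      have "card ({1..i'} - S) \<le> card ({1..n} - S)"
        using i' by (intro card_mono) auto
      also have "\<dots> = n - card S"
        using S(1) finite_subset[OF S(1)] by (simp add: card_Diff_subset)
      finally have "card ({1..i'} - S) + card S \<le> n"
        using card_mono[OF _ S(1)] by simp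
      \<comment> \<open>The right-hand side is \<open>n\<close> minus the number of agents served
        before; the skipped agents guarantee that it is at least \<open>card S\<close>.\<close>
      then have "2 * ln n \<le> real (n - t) + (real t - card ({1..i'} - S))"
        using Rt S(2) by (simp add: of_nat_diff)
      then have "exp (2 * ln n) \<le> exp (real (n - t)) * exp (real t - card ({1..i'} - S))"
        by (simp flip: exp_add)
      also have "\<dots> \<le> potential n S P w i' st"
        using exp_le by (simp add: potential_def eq)
      finally show "(real n)\<^sup>2 \<le> potential n S P w i' st"
        using n by (simp add: exp_double)
    qed
  qed
  let ?c = "1 / (real n)\<^sup>2"
  have "emeasure (single_or_sample_state 4 n m S \<sigma> i) ?low
      = (\<integral>\<^sup>+ st. emeasure (agent_round 4 n \<sigma> i st) ?low \<partial>?\<mu>)"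
    using i i' by (simp add: emeasure_bind_pmf)
  also have "\<dots> \<le> (\<integral>\<^sup>+ st. ennreal ?c * ennreal (\<Psi> st) \<partial>?\<mu>)"
  \<comment> \<open>Pointwise Markov: from each state the low event either has probability
    \<open>0\<close> or forces the right-hand side to be at least \<open>1\<close>.\<close>
  proof (intro nn_integral_mono_AE AE_pmfI)
    fix st assume st: "st \<in> set_pmf ?\<mu>"
    show "emeasure (agent_round 4 n \<sigma> i st) ?low \<le> ennreal ?c * ennreal (\<Psi> st)"
    proof (cases "set_pmf (agent_round 4 n \<sigma> i st) \<inter> ?low = {}")
      case True
      then have "emeasure (agent_round 4 n \<sigma> i st) ?low = 0"
        by (simp add: measure_pmf.emeasure_eq_measure measure_pmf_zero_iff)
      then show ?thesis
        by simp
    next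
      case False
      then have "(real n)\<^sup>2 \<le> \<Psi> st"
        using \<Psi>(2)[OF st] by blast
      then have "1 \<le> ennreal (?c * \<Psi> st)"
        using n by (simp add: field_simps)
      then have "1 \<le> ennreal ?c * ennreal (\<Psi> st)"
        by (subst ennreal_mult'[symmetric]) simp_all
      then show ?thesis
        using measure_pmf.emeasure_le_1 by (rule order.trans[rotated])
    qed
  qed
  also have "\<dots> = ennreal ?c * (\<integral>\<^sup>+ st. ennreal (\<Psi> st) \<partial>?\<mu>)"
    by (rule nn_integral_cmult) simp
  also have "\<dots> \<le> ennreal ?c * 1"
    using \<Psi>(1) by (intro mult_left_mono) auto
  finally show ?thesis
    by simp
qed

text \<open>Each round writes only the bundle of the arriving agent, so the bundle of
  \<open>i\<close> is final after round \<open>i\<close>. From a state of a later round the event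
  has probability \<open>0\<close> or \<open>1\<close>.\<close>

lemma emeasure_bundle_after_arrival:
  assumes "i \<le> j"
  shows "emeasure (single_or_sample_state k n m S \<sigma> j) {(R, t, A). Q (A i)}
    = emeasure (single_or_sample_state k n m S \<sigma> i) {(R, t, A). Q (A i)}"
  using assms
proof (induction j rule: dec_induct)
  case (step j)
  let ?X = "{(R, t, A). Q (A i)} :: state set"
  let ?\<mu> = "single_or_sample_state k n m S \<sigma>"
  let ?N = "\<lambda>st. if Suc j \<in> S then return_pmf st else agent_round k n \<sigma> (Suc j) st"
  have "emeasure (?\<mu> (Suc j)) ?X = (\<integral>\<^sup>+ st. emeasure (?N st) ?X \<partial>?\<mu> j)"
    by (simp add: emeasure_bind_pmf)
  also have "\<dots> = (\<integral>\<^sup>+ st. indicator ?X st \<partial>?\<mu> j)"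
  proof (intro nn_integral_cong)
    fix st
    have "st' \<in> ?X \<longleftrightarrow> st \<in> ?X" if "st' \<in> set_pmf (?N st)" for st'
      using that step(1) by (cases st) (auto simp: agent_round_def split: if_splits option.splits)
    then have "emeasure (?N st) ?X = emeasure (?N st) (if st \<in> ?X then UNIV else {})"
      by (intro emeasure_eq_AE AE_pmfI) auto
    then show "emeasure (?N st) ?X = indicator ?X st"
      by simp
  qed
  also have "\<dots> = emeasure (?\<mu> j) ?X"
    by simp
  finally show ?case
    using step.IH by simp
qed simp

lemma agent_low_value_bound:
  assumes "1 \<le> n" "monotone_valuation m v" "submodular m v" "1 \<le> MMS n m v"
    and "S \<subseteq> {1..n}" "2 * ln (real n) \<le> card S"
    and "i \<in> {1..n} - S" "safe_strategy 4 n m (1 / 24) v (\<sigma> i)"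
  shows "measure_pmf.prob (single_or_sample 4 n m S \<sigma>) {A. v (A i) < 1 / 24} \<le> 1 / (real n)\<^sup>2"
proof -
  have "emeasure (single_or_sample 4 n m S \<sigma>) {A. v (A i) < 1 / 24}
      = emeasure (single_or_sample_state 4 n m S \<sigma> n) {(R, t, A). v (A i) < 1 / 24}"
    unfolding single_or_sample_def by (simp add: case_prod_unfold vimage_def)
  also have "\<dots> = emeasure (single_or_sample_state 4 n m S \<sigma> i) {(R, t, A). v (A i) < 1 / 24}"
    using assms(7) by (intro emeasure_bundle_after_arrival[where Q = "\<lambda>X. v X < 1 / 24"]) simp
  also have "\<dots> \<le> ennreal (1 / (real n)\<^sup>2)"
    using assms by (rule agent_low_value_at_arrival[where \<sigma> = \<sigma>])
  finally show ?thesis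
    by (simp add: measure_pmf.emeasure_eq_measure)
qed

theorem lemma6p1:
  fixes n m :: nat
    and v :: "nat \<Rightarrow> nat set \<Rightarrow> real"
    and S :: "nat set"
    and \<sigma> :: "nat \<Rightarrow> strategy"
  assumes "1 \<le> n"
    and "\<And>i. i \<in> {1..n} \<Longrightarrow> monotone_valuation m (v i)"
    and "\<And>i. i \<in> {1..n} \<Longrightarrow> submodular m (v i)"
    and "\<And>i. i \<in> {1..n} \<Longrightarrow> MMS n m (v i) = 1"
    and "S \<subseteq> {1..n}"
    and "int (card S) = \<lceil>2 * ln (real n)\<rceil>"
    and "\<And>i. i \<in> {1..n} - S \<Longrightarrow> safe_strategy 4 n m (1 / 24) (v i) (\<sigma> i)"
  shows "measure_pmf.prob (single_or_sample 4 n m S \<sigma>)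
           {A. \<forall>i \<in> {1..n} - S. v i (A i) \<ge> 1 / 24 * MMS n m (v i)} \<ge> 1 - 1 / real n"
proof -
  let ?M = "measure_pmf (single_or_sample 4 n m S \<sigma>)"
  let ?I = "{1..n} - S"
  let ?low = "\<lambda>i. {A. v i (A i) < 1 / 24}"
  have cardS: "2 * ln (real n) \<le> card S"
    using assms(6) by linarith
  have "measure ?M (\<Union>i\<in>?I. ?low i) \<le> (\<Sum>i\<in>?I. measure ?M (?low i))"
    by (intro measure_pmf.finite_measure_subadditive_finite) auto
  also have "\<dots> \<le> (\<Sum>i\<in>?I. 1 / (real n)\<^sup>2)"
    using assms cardS by (intro sum_mono agent_low_value_bound) auto
  \<comment> \<open>At most \<open>n\<close> agents take part.\<close>
  also have "\<dots> \<le> real n * (1 / (real n)\<^sup>2)"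
    using card_mono[of "{1..n}" ?I] by (simp add: divide_right_mono)
  also have "\<dots> = 1 / n"
    by (simp add: power2_eq_square)
  finally have "measure ?M (\<Union>i\<in>?I. ?low i) \<le> 1 / n" .
  moreover have "{A. \<forall>i\<in>?I. v i (A i) \<ge> 1 / 24 * MMS n m (v i)} = {A. \<forall>i\<in>?I. \<not> v i (A i) < 1 / 24}"
    using assms(4) by (intro Collect_cong ball_cong) auto
  moreover have "\<dots> = UNIV - (\<Union>i\<in>?I. ?low i)"
    by blast
  ultimately show ?thesis
    using measure_pmf.prob_compl[of "\<Union>i\<in>?I. ?low i" "single_or_sample 4 n m S \<sigma>"] by simp
qed

end
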